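(* Let $X=\{a_1,\dots,a_n\}$, let $\mathcal{F}$ be a union-closed family of subsets of $X$ with $\bigcup_{f\in\mathcal{F}}f=X$, let $w=a_1\cdots a_n$ and $\mathcal{U}=\varphi_w(\mathcal{F})$. Then for each $f\in\mathcal{F}$, $\varphi_w$ restricts to a bijection $$\varphi_w:\mathcal{F}[f]\to\mathcal{U}[f],$$ where $\mathcal{F}[f]=\{g\in\mathcal{F}:f\subseteq g\}$ and $\mathcal{U}[f]=\{\eta\in\mathcal{U}:f\subseteq\eta\}$.
   Context: Union-closed: $f,g\in\mathcal{F}\Rightarrow f\cup g\in\mathcal{F}$. Rising functions: for $T\subseteq 2^X$ and $a\in X$, $\varphi_{T,a}:T\to2^X$ is $\varphi_{T,a}(z)=z\cup\{a\}$ if $z\cup\{a\}\notin T$, and $\varphi_{T,a}(z)=z$ otherwise. With $\varphi_0=\mathrm{id}$, $\mathcal{F}_0=\mathcal{F}$, and for $1\le j\le n$, $\varphi_j=\varphi_{\mathcal{F}_{j-1},a_j}\circ\varphi_{j-1}$, $\mathcal{F}_j=\varphi_j(\mathcal{F})$, the rising function with respect to $w$ is $\varphi_w=\varphi_n:\mathcal{F}\to2^X$. *)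

theory Defs
  imports Main
begin

definition union_closed :: "'a set set \<Rightarrow> bool" where
  "union_closed F \<longleftrightarrow> (\<forall>f\<in>F. \<forall>g\<in>F. f \<union> g \<in> F)"

text \<open>The rising function of the family \<open>T\<close> at \<open>a\<close>. Its domain is \<open>T\<close>; the values of the
  total HOL function outside \<open>T\<close> carry no meaning.\<close>

definition rising :: "'a set set \<Rightarrow> 'a \<Rightarrow> 'a set \<Rightarrow> 'a set" where
  "rising T a z = (if insert a z \<notin> T then insert a z else z)"

text \<open>\<open>rising_step F w j\<close> is $\varphi_j$, and its image of \<open>F\<close> is ${\cal F}_j$. Lists are indexed
  from 0, so the letter $a_{j+1}$ of the word is \<open>w ! j\<close>.\<close>

primrec rising_step :: "'a set set \<Rightarrow> 'a list \<Rightarrow> nat \<Rightarrow> 'a set \<Rightarrow> 'a set" where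
  "rising_step F w 0 = id"
| "rising_step F w (Suc j) = rising (rising_step F w j ` F) (w ! j) \<circ> rising_step F w j"

definition rising_word :: "'a set set \<Rightarrow> 'a list \<Rightarrow> 'a set \<Rightarrow> 'a set" where
  "rising_word F w = rising_step F w (length w)"

definition members_above :: "'a set set \<Rightarrow> 'a set \<Rightarrow> 'a set set" where
  "members_above F f = {g \<in> F. f \<subseteq> g}"

end

theory Submission
  imports Defs
begin

text \<open>Rising maps are injective and enlarge sets, so everything reduces to showing that
  \<open>f \<subseteq> \<phi>\<^sub>w g\<close> forces \<open>f \<subseteq> g\<close> for \<open>f, g \<in> F\<close>. Each family \<open>F\<^sub>j\<close> stays closed under
  union with members of the original \<open>F\<close>. If a rising step turned \<open>z \<in> F\<^sub>j\<close> with
  \<open>\<not> f \<subseteq> z\<close> into \<open>z \<union> {a} \<supseteq> f\<close>, then \<open>z \<union> {a} = f \<union> z\<close> would already lie in \<open>F\<^sub>j\<close>, and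
  \<open>z\<close> would not have been moved.\<close>

text \<open>A moved set lands outside \<open>T\<close> and an unmoved one stays in \<open>T\<close>,
  so equal values come from two moved or two unmoved sets; moved sets both lack
  \<open>a\<close>.\<close>

lemma inj_on_rising: "inj_on (rising T a) T"
proof (rule inj_onI)
  fix y z
  assume "y \<in> T" "z \<in> T" and eq: "rising T a y = rising T a z"
  show "y = z"
  proof (cases "insert a y \<in> T \<or> insert a z \<in> T")
    case True
    with eq \<open>y \<in> T\<close> \<open>z \<in> T\<close> show ?thesis
      by (auto simp: rising_def split: if_splits)
  next
    case False
    with \<open>y \<in> T\<close> \<open>z \<in> T\<close> have "a \<notin> y" "a \<notin> z"
      by (auto simp: insert_absorb)
    moreover from False eq have "insert a y = insert a z"
      by (simp add: rising_def)
    ultimately show ?thesis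
      by (simp add: insert_ident)
  qed
qed

lemma rising_image_Un_closed:
  assumes closed: "\<And>z. z \<in> T \<Longrightarrow> f \<union> z \<in> T" and "y \<in> rising T a ` T"
  shows "f \<union> y \<in> rising T a ` T"
proof -
  obtain z where z: "z \<in> T" "y = rising T a z"
    using assms(2) by blast
  show ?thesis
  proof (cases "insert a (f \<union> z) \<in> T")
    case False
    \<comment> \<open>Otherwise closure would put \<open>f \<union> insert a z\<close>, which is
      \<open>insert a (f \<union> z)\<close>, in \<open>T\<close>. So \<open>z\<close> and
      \<open>f \<union> z\<close> both move.\<close>
    then have "insert a z \<notin> T"
      using closed[of "insert a z"] by auto
    with False z have "f \<union> y = rising T a (f \<union> z)"
      by (simp add: rising_def)
    with z closed show ?thesis by blast
  next
    case True
    \<comment> \<open>Here \<open>f \<union> z\<close> need not map to \<open>f \<union> y\<close>;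
      instead \<open>f \<union> y\<close> is a fixed point and serves as its own preimage.\<close>
    have "f \<union> y \<in> T \<and> insert a (f \<union> y) \<in> T"
    proof (cases "insert a z \<in> T")
      case True
      then have "y = z" using z by (simp add: rising_def)
      with \<open>insert a (f \<union> z) \<in> T\<close> closed[OF z(1)] show ?thesis by simp
    next
      case False
      then have "y = insert a z" using z by (simp add: rising_def)
      with \<open>insert a (f \<union> z) \<in> T\<close> show ?thesis by simp
    qed
    then have "f \<union> y \<in> T" "rising T a (f \<union> y) = f \<union> y"
      by (auto simp: rising_def)
    then show ?thesis by (metis imageI)
  qed
qed

lemma subset_rising: "z \<subseteq> rising T a z"
  by (auto simp: rising_def)

lemma subset_rising_iff:
  assumes "\<And>z. z \<in> T \<Longrightarrow> f \<union> z \<in> T" "z \<in> T"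
  shows "f \<subseteq> rising T a z \<longleftrightarrow> f \<subseteq> z"
proof
  assume le: "f \<subseteq> rising T a z"
  show "f \<subseteq> z"
  proof (rule ccontr)
    assume nle: "\<not> f \<subseteq> z"
    with le have "insert a z \<notin> T" "f \<subseteq> insert a z"
      by (auto simp: rising_def split: if_splits)
    moreover from this nle have "f \<union> z = insert a z"
      by auto
    ultimately show False
      using assms by metis
  qed
qed (rule subset_trans[OF _ subset_rising])

lemma inj_on_rising_step: "inj_on (rising_step F w j) F"
proof (induction j)
  case (Suc j)
  then show ?case
    by (simp only: rising_step.simps comp_inj_on inj_on_rising)
qed simp

lemma rising_step_image_Un_closed:
  assumes "union_closed F" "f \<in> F" "z \<in> rising_step F w j ` F"
  shows "f \<union> z \<in> rising_step F w j ` F"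
  using assms(3)
proof (induction j arbitrary: z)
  case 0
  with assms show ?case by (simp add: union_closed_def)
next
  case (Suc j)
  then show ?case
    using rising_image_Un_closed[of "rising_step F w j ` F" f z "w ! j"]
    by (simp add: image_comp)
qed

lemma subset_rising_step_iff:
  assumes "union_closed F" "f \<in> F" "g \<in> F"
  shows "f \<subseteq> rising_step F w j g \<longleftrightarrow> f \<subseteq> g"
proof (induction j)
  case (Suc j)
  then show ?case
    using subset_rising_iff[OF rising_step_image_Un_closed[OF assms(1,2)]] assms(3) by simp
qed simp

theorem theorem3p4:
  fixes X :: "'a set" and F U :: "'a set set" and w :: "'a list"
  assumes "distinct w" and "set w = X"
    and "F \<subseteq> Pow X" and "union_closed F" and "\<Union>F = X"
    and "U = rising_word F w ` F"
  shows "\<forall>f\<in>F. bij_betw (rising_word F w) (members_above F f) (members_above U f)"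
proof
  fix f
  assume "f \<in> F"
  then have iff: "f \<subseteq> rising_word F w g \<longleftrightarrow> f \<subseteq> g" if "g \<in> F" for g
    using assms(4) that by (simp add: rising_word_def subset_rising_step_iff)
  have "inj_on (rising_word F w) (members_above F f)"
    by (rule inj_on_subset[of _ F])
      (auto simp: rising_word_def members_above_def inj_on_rising_step)
  \<comment> \<open>Each member of \<open>U\<close> is the image of some \<open>g \<in> F\<close>;
    \<open>iff\<close> read from left to right places \<open>g\<close> above \<open>f\<close>, which
    gives surjectivity.\<close>
  moreover have "rising_word F w ` members_above F f = members_above U f"
    using iff by (auto simp: members_above_def assms(6))
  ultimately show "bij_betw (rising_word F w) (members_above F f) (members_above U f)"
    by (simp add: bij_betw_def)
qed

end
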